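(* Let $f(x)$ be a regular function such that $f(-x)=f(x)$. Then, in the sense of the generalized summation method described in the context, $$\sum_{u=1}^{\infty}f(u)=-\frac{f(0)}{2},$$ independently of whether the series is convergent or not in the usual sense.
   Context: Re-ordering of $\mathbb{Z}$: $a\prec b$ iff $\frac{-1}{a}<\frac{-1}{b}$ (convention $0^{-1}=\infty$), so that $0\prec 1\prec 2\prec\cdots\prec -2\prec -1$ (first element $0$, last element $-1$). Intervals $[a,b]$, $(a,b)$ are taken with respect to $\prec$. Put $\mathbb{Z}_{a,b}=[a,b]$ if $a\preceq b$, and $\mathbb{Z}_{a,b}=\mathbb{Z}\setminus(b,a)=[a,-1]\cup[0,b]$ if $b\prec a$. For a function $f$ on $\mathbb{Z}$ and any $a,b\in\mathbb{Z}$, $\sum_{u=a}^{b}f(u):=\sum_{u\in\mathbb{Z}_{a,b}}f(u)$ (observing the order of elements in $\mathbb{Z}_{a,b}$); if $\mathbb{Z}_{a,b}$ is infinite this is an infinite series. An elementary function is one given by a formula built by finitely many algebraic operations, compositions and combinations from constant, algebraic, trigonometric and exponential functions and their inverses. A function $f$ on $\mathbb{Z}$ is regular if there is an elementary function $F$ (a primitive of $f$) with $F(x+1)-F(x)=f(x)$ for all $x\in\mathbb{Z}$. Summation method. Postulate: every series $\sum_{u=1}^{\infty}f(u)$ with $f$ regular has a certain finite numeric value. Axioms: (A1) if $S_n=\sum_{u=a}^{n}f(u)$ for all $n$, then $\lim_{n\to\infty}S_n=\sum_{u=a}^{\infty}f(u)$; (A2) if $S_n=\sum_{u=1}^{[n/2]}f(u)$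 for all $n$, then $\lim_{n\to\infty}S_n=\sum_{u=1}^{\infty}f(u)$ ($[\cdot]$ = integer part); (A3) if $\sum_{u=a}^{\infty}f_1(u)=S_1$ and $\sum_{u=a}^{\infty}f_2(u)=S_2$, then $\sum_{u=a}^{\infty}(\alpha_1f_1(u)+\alpha_2f_2(u))=\alpha_1S_1+\alpha_2S_2$; (A4) if $G=[a_1,b_1]\cup[a_2,b_2]$ with $[a_1,b_1]\cap[a_2,b_2]=\emptyset$, then $\sum_{u\in G}f(u)=\sum_{u=a_1}^{b_1}f(u)+\sum_{u=a_2}^{b_2}f(u)$. Limits: $\lim_{n\to\infty}F(n)=A$ means $\sum_{u=1}^{\infty}f(u)=A$ where $f(1)=F(1)$ and $f(u)=F(u)-F(u-1)$ for $u>1$; by the postulate every elementary function of an integer argument defined on $\mathbb{Z}$ has a definite limit. All limits and infinite sums are understood in this generalized sense (agreeing with the usual one for convergent sequences and series). Conventions: sums retain their analytical expression, i.e. for $f$ regular with primitive $F$, $\sum_{u=a}^{b}f(u)=F(b+1)-F(a)$ whenever $a\preceq b$; and $\lim_{n\to\infty}\sum_{u\in\mathbb{Z}_{-n,n}}f(u)=\sum_{u\in\mathbb{Z}}f(u)$. *)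

theory Defs
  imports Complex_Main "HOL-Library.Extended_Real" "HOL-Computational_Algebra.Polynomial"
begin

text \<open>In \<^typ>\<open>ereal\<close> we have \<^prop>\<open>inverse 0 = (\<infinity>::ereal)\<close>, which is the convention
  needed here; so \<open>0\<close> gets the key \<open>-\<infinity>\<close> and comes first.\<close>

definition prec :: "int \<Rightarrow> int \<Rightarrow> bool"  (infix \<open>\<prec>\<close> 50)
  where "a \<prec> b \<longleftrightarrow> (- 1) / ereal (of_int a) < (- 1) / ereal (of_int b)"

definition preceq :: "int \<Rightarrow> int \<Rightarrow> bool"  (infix \<open>\<preceq>\<close> 50)
  where "a \<preceq> b \<longleftrightarrow> a \<prec> b \<or> a = b"

definition prec_closed :: "int \<Rightarrow> int \<Rightarrow> int set"
  where "prec_closed a b = {u. a \<preceq> u \<and> u \<preceq> b}"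

definition prec_open :: "int \<Rightarrow> int \<Rightarrow> int set"
  where "prec_open a b = {u. a \<prec> u \<and> u \<prec> b}"

definition Zint :: "int \<Rightarrow> int \<Rightarrow> int set"
  where "Zint a b = (if a \<preceq> b then prec_closed a b else UNIV - prec_open b a)"


text \<open>A real algebraic function is a continuous branch, on an interval, of \<open>P(x, y) = 0\<close>
  for a nonzero bivariate polynomial; \<open>P\<close> is a polynomial in \<open>y\<close> with coefficients in
  \<open>\<real>[x]\<close>.  Without continuity on an interval every function with finitely many values
  would qualify.\<close>

definition algebraic_fun_on :: "real set \<Rightarrow> (real \<Rightarrow> real) \<Rightarrow> bool"
  where "algebraic_fun_on I y \<longleftrightarrow> connected I \<and> continuous_on I y \<and>
    (\<exists>P :: real poly poly. P \<noteq> 0 \<and> (\<forall>x\<in>I. poly (poly P [:y x:]) x = 0))"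

text \<open>\<open>elementary_on D F\<close>: \<open>F\<close> is given by a formula that is meaningful at every point
  of \<open>D\<close>.  The domains keep the totalised values (such as \<open>1 / 0 = 0\<close>, \<open>ln 0 = 0\<close>) out.
  The identity and the roots are algebraic functions; general powers come from \<open>exp\<close>
  and \<open>ln\<close>.\<close>

inductive elementary_on :: "real set \<Rightarrow> (real \<Rightarrow> real) \<Rightarrow> bool"
  where
    const: "elementary_on D (\<lambda>x. c)"
  | algebraic: "algebraic_fun_on I y \<Longrightarrow> elementary_on I y"
  | exp: "elementary_on UNIV exp"
  | ln: "elementary_on {0<..} ln"
  | sin: "elementary_on UNIV sin"
  | cos: "elementary_on UNIV cos"
  | tan: "elementary_on {x. cos x \<noteq> 0} tan"
  | arcsin: "elementary_on {-1..1} arcsin"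
  | arccos: "elementary_on {-1..1} arccos"
  | arctan: "elementary_on UNIV arctan"
  | add: "elementary_on D F \<Longrightarrow> elementary_on D G \<Longrightarrow> elementary_on D (\<lambda>x. F x + G x)"
  | diff: "elementary_on D F \<Longrightarrow> elementary_on D G \<Longrightarrow> elementary_on D (\<lambda>x. F x - G x)"
  | mult: "elementary_on D F \<Longrightarrow> elementary_on D G \<Longrightarrow> elementary_on D (\<lambda>x. F x * G x)"
  | divide: "elementary_on D F \<Longrightarrow> elementary_on D G \<Longrightarrow> (\<And>x. x \<in> D \<Longrightarrow> G x \<noteq> 0)
      \<Longrightarrow> elementary_on D (\<lambda>x. F x / G x)"
  | comp: "elementary_on E G \<Longrightarrow> elementary_on D F \<Longrightarrow> (\<And>x. x \<in> D \<Longrightarrow> F x \<in> E)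
      \<Longrightarrow> elementary_on D (\<lambda>x. G (F x))"
  | subset: "elementary_on E F \<Longrightarrow> D \<subseteq> E \<Longrightarrow> elementary_on D F"

definition primitive :: "(int \<Rightarrow> real) \<Rightarrow> (int \<Rightarrow> real) \<Rightarrow> bool"
  where "primitive F f \<longleftrightarrow>
    (\<exists>G. elementary_on \<int> G \<and> (\<forall>x. F x = G (of_int x))) \<and> (\<forall>x. F (x + 1) - F x = f x)"

definition regular :: "(int \<Rightarrow> real) \<Rightarrow> bool"
  where "regular f \<longleftrightarrow> (\<exists>F. primitive F f)"


text \<open>A summation method is an operator \<open>S\<close> with \<open>S G f\<close> the value of the sum of \<open>f\<close> over
  the set \<open>G\<close> of integers; the series from \<open>a\<close> to \<open>\<infinity>\<close> is the sum over \<open>{a..}\<close>.\<close>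

type_synonym summation = "int set \<Rightarrow> (int \<Rightarrow> real) \<Rightarrow> real"

definition gsum :: "summation \<Rightarrow> (int \<Rightarrow> real) \<Rightarrow> int \<Rightarrow> int \<Rightarrow> real"
  where "gsum S f a b = S (Zint a b) f"

definition gseries :: "summation \<Rightarrow> (int \<Rightarrow> real) \<Rightarrow> int \<Rightarrow> real"
  where "gseries S f a = S {a..} f"

text \<open>The generalised limit of \<open>F\<close> is the value of the series with first term \<open>F(1)\<close> and
  further terms \<open>F(u) - F(u - 1)\<close>, \<open>u > 1\<close>.  The first term is split off because only
  the further terms are given by a regular function on the integers.\<close>

definition glim :: "summation \<Rightarrow> (int \<Rightarrow> real) \<Rightarrow> real"
  where "glim S F = F 1 + gseries S (\<lambda>u. F u - F (u - 1)) 2"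

text \<open>The postulate that the series of a regular function has a definite finite value is
  the totality of \<open>S\<close>; values at functions that are not regular are unconstrained, except
  on finite sets.

  That generalised values agree with the usual ones for convergent series is not
  assumed, and neither is that \<open>S G f\<close> depends on \<open>f\<close> only through its values on \<open>G\<close>.
  Each of them would contradict the remaining axioms: the differences of the elementary
  function \<open>arctan (x - 1/2)\<close> form an even regular function with a usual sum from \<open>1\<close>
  of \<open>pi / 2 - arctan (1/2)\<close>, and the indicator of \<open>{0}\<close> is even and regular, with
  primitive \<open>(x - 1/2) / (2 * sqrt ((x - 1/2)^2))\<close>.
  The axioms below do have a model: for finite \<open>G\<close> the ordinary sum, for cofinite \<open>G\<close> minus
  the sum over the complement, and otherwise
  \<open>- f(0)/2\<close> plus the sum over \<open>G - {1..}\<close> minus the sum over \<open>{1..} - G\<close>.\<close>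

locale summation_method =
  fixes S :: summation
  assumes finite_sum: "finite G \<Longrightarrow> S G f = (\<Sum>u\<in>G. f u)"
    and A1: "regular f \<Longrightarrow> glim S (\<lambda>n. gsum S f a n) = gseries S f a"
    and A2: "regular f \<Longrightarrow> glim S (\<lambda>n. gsum S f 1 (n div 2)) = gseries S f 1"
    and A3: "regular f\<^sub>1 \<Longrightarrow> regular f\<^sub>2 \<Longrightarrow>
      gseries S (\<lambda>u. \<alpha>\<^sub>1 * f\<^sub>1 u + \<alpha>\<^sub>2 * f\<^sub>2 u) a
        = \<alpha>\<^sub>1 * gseries S f\<^sub>1 a + \<alpha>\<^sub>2 * gseries S f\<^sub>2 a"
    and A4: "regular f \<Longrightarrow> a\<^sub>1 \<preceq> b\<^sub>1 \<Longrightarrow> a\<^sub>2 \<preceq> b\<^sub>2 \<Longrightarrow>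
      prec_closed a\<^sub>1 b\<^sub>1 \<inter> prec_closed a\<^sub>2 b\<^sub>2 = {} \<Longrightarrow>
      S (prec_closed a\<^sub>1 b\<^sub>1 \<union> prec_closed a\<^sub>2 b\<^sub>2) f = gsum S f a\<^sub>1 b\<^sub>1 + gsum S f a\<^sub>2 b\<^sub>2"
    and analytic_expression: "primitive F f \<Longrightarrow> a \<preceq> b \<Longrightarrow> gsum S f a b = F (b + 1) - F a"
    and symmetric_limit: "regular f \<Longrightarrow> glim S (\<lambda>n. gsum S f (- n) n) = S UNIV f"

end

theory Submission
  imports Defs
begin

text \<open>Let \<open>F\<close> be a primitive of \<open>f\<close>. In the cyclic order \<open>\<prec>\<close> the formula
  \<open>\<Sum>\<^sub>a\<^sup>b f = F (b + 1) - F a\<close> holds for all integers \<open>a, b\<close>; in particular the sum over all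
  of the integers is the sum from \<open>0\<close> to \<open>-1\<close> and vanishes. For even \<open>f\<close> the symmetric partial sums
  over \<open>{-n..n}\<close> have increments \<open>2 f(n)\<close>, so their generalised limit is both \<open>0\<close> and
  \<open>f(0) + 2 \<Sum>\<^sub>1 f\<close>.\<close>

text \<open>The key -1/a increases on each sign class, is negative exactly for positive a, and is
  minus infinity at 0.\<close>

lemma prec_iff: "a \<prec> b \<longleftrightarrow> b \<noteq> 0 \<and> (a = 0 \<or> (0 < a \<and> b < 0) \<or> (a < b \<and> (0 < a \<longleftrightarrow> 0 < b)))"
proof (cases "a = 0 \<or> b = 0")
  case True
  then show ?thesis
    by (auto simp: prec_def divide_ereal_def)
next
  case False
  then have "a \<prec> b \<longleftrightarrow> - 1 / real_of_int a < - 1 / real_of_int b"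
    unfolding prec_def
    by (simp add: one_ereal_def)
  then show ?thesis
    using False by (cases "0 < a"; cases "0 < b") (auto simp: field_simps)
qed

lemma preceq_first: "0 \<preceq> a"
  by (auto simp: preceq_def prec_iff)

lemma preceq_last: "a \<preceq> -1"
  by (auto simp: preceq_def prec_iff)

lemma not_preceq_iff: "\<not> a \<preceq> b \<longleftrightarrow> b \<prec> a"
  by (auto simp: preceq_def prec_iff)

lemma Zint_first_last: "Zint 0 (-1) = UNIV"
  by (simp add: Zint_def prec_closed_def preceq_first preceq_last)

lemma Zint_wrap:
  assumes "\<not> a \<preceq> b"
  shows "Zint a b = prec_closed 0 b \<union> prec_closed a (-1)"
  using assms
  by (auto simp: Zint_def prec_closed_def prec_open_def preceq_first preceq_last
      simp flip: not_preceq_iff)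

lemma prec_closed_wrap_disjoint:
  assumes "\<not> a \<preceq> b"
  shows "prec_closed 0 b \<inter> prec_closed a (-1) = {}"
  using assms by (auto simp: prec_closed_def preceq_def prec_iff split: if_splits)

context summation_method
begin

text \<open>If \<open>b \<prec> a\<close>, the arc passes from -1 to 0, and \<open>F 0\<close>
  cancels between its two pieces.\<close>

lemma gsum_primitive:
  assumes F: "primitive F f"
  shows "gsum S f a b = F (b + 1) - F a"
proof (cases "a \<preceq> b")
  case True
  then show ?thesis
    by (rule analytic_expression[OF F])
next
  case False
  have "regular f"
    using F by (auto simp: regular_def)
  then have "gsum S f a b = gsum S f 0 b + gsum S f a (-1)"
    unfolding gsum_def[of S f a b] Zint_wrap[OF False]
    by (intro A4 preceq_first preceq_last prec_closed_wrap_disjoint[OF False])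
  then show ?thesis
    using analytic_expression[OF F preceq_first, of b] analytic_expression[OF F preceq_last, of a]
    by simp
qed

lemma sum_UNIV_eq_0:
  assumes "regular f"
  shows "S UNIV f = 0"
proof -
  obtain F where "primitive F f"
    using assms by (auto simp: regular_def)
  from gsum_primitive[OF this, of 0 "-1"] show ?thesis
    by (simp add: gsum_def Zint_first_last)
qed

text \<open>By \<open>gsum_primitive\<close> the partial sums have increment \<open>f u\<close> at
  every integer u; agreement on \<open>{2..}\<close> alone would not suffice, since \<open>S\<close>
  may look outside it.\<close>

lemma gseries_split_first:
  assumes "regular f"
  shows "gseries S f 1 = f 1 + gseries S f 2"
proof -
  obtain F where F: "primitive F f"
    using assms by (auto simp: regular_def)
  have step: "F (u + 1) - F u = f u" for u
    using F by (simp add: primitive_def)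
  show ?thesis
    using A1[OF assms, of 1] step[of 1] by (simp add: glim_def gsum_primitive[OF F] step)
qed

lemma gseries_even:
  assumes f: "regular f" and even: "\<And>x. f (- x) = f x"
  shows "gseries S f 1 = - f 0 / 2"
proof -
  obtain F where F: "primitive F f"
    using f by (auto simp: regular_def)
  have step: "F (u + 1) - F u = f u" for u
    using F by (simp add: primitive_def)
  define H where "H n = gsum S f (- n) n" for n
  have H: "H n = F (n + 1) - F (- n)" for n
    unfolding H_def by (rule gsum_primitive[OF F])
  have H1: "H 1 = f 0 + 2 * f 1"
    using step[of "-1"] step[of 0] step[of 1] even[of 1] by (simp add: H)
  \<comment> \<open>The new terms are \<open>f u\<close> and \<open>f (- u)\<close>; the factors 1
    match the form of \<open>A3\<close>.\<close>
  have "H u - H (u - 1) = 1 * f u + 1 * f u" for u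
    using step[of u] step[of "- u"] even[of u] by (simp add: H)
  then have "glim S H = H 1 + 2 * gseries S f 2"
    unfolding glim_def by (simp only: A3[OF f f])
  moreover have "glim S H = 0"
    using symmetric_limit[OF f] sum_UNIV_eq_0[OF f] by (simp add: H_def[abs_def])
  ultimately show ?thesis
    using H1 gseries_split_first[OF f] by simp
qed

end

theorem theorem4p1:
  fixes S :: summation and f :: "int \<Rightarrow> real"
  assumes "summation_method S"
    and "regular f"
    and "\<And>x. f (- x) = f x"
  shows "gseries S f 1 = - f 0 / 2"
  using assms by (rule summation_method.gseries_even)

end
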